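(* Let $\mathscr{G}=(G_1,G_0)$ be a groupoid. Then the following are equivalent: (i) for every map $\varsigma:X\to G_0$, the induced morphism of groupoids $\phi^{\varsigma}:\mathscr{G}^{\varsigma}\to\mathscr{G}$ is a weak equivalence; (ii) $\mathscr{G}$ is a transitive groupoid; (iii) for every map $\varsigma:X\to G_0$, the pull-back biset $(\phi^{\varsigma})^{*}(\mathscr{U}(\mathscr{G}))$ is a principal $(\mathscr{G},\mathscr{G}^{\varsigma})$-biset.
   Context: A groupoid $\mathscr{G}=(G_1,G_0)$ is a small category with all arrows invertible; $\mathsf{s},\mathsf{t}:G_1\to G_0$ are source and target, $\iota$ the identity map, and $fg$ is defined when $\mathsf{s}(f)=\mathsf{t}(g)$. It is transitive if $(\mathsf{s},\mathsf{t}):G_1\to G_0\times G_0$ is surjective. A morphism of groupoids is a functor; it is a weak equivalence if it is essentially surjective and fully faithful. Induced groupoid: for a set $X$ and a map $\varsigma:X\to G_0$, $\mathscr{G}^{\varsigma}$ has objects $X$ and arrows $\{(x,g,x')\in X\times G_1\times X\mid\varsigma(x)=\mathsf{t}(g),\ \varsigma(x')=\mathsf{s}(g)\}$, source $(x,g,x')\mapsto x'$, target $(x,g,x')\mapsto x$, multiplication $(x,g,y)(y,g',y')=(x,gg',y')$. The morphism $\phi^{\varsigma}:\mathscr{G}^\varsigma\to\mathscr{G}$ is $\varsigma$ on objects and $(x,g,x')\mapsto g$ on arrows. Bisets: for groupoids $\mathscr{H},\mathscr{G}$, an $(\mathscr{H},\mathscr{G})$-biset is a set $Z$ with maps $\vartheta:Z\to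 H_0$, $\varsigma:Z\to G_0$, a left $\mathscr{H}$-action ($hz$ defined when $\mathsf{s}(h)=\vartheta(z)$, with $\vartheta(hz)=\mathsf{t}(h)$) and a right $\mathscr{G}$-action ($zg$ defined when $\varsigma(z)=\mathsf{t}(g)$, with $\varsigma(zg)=\mathsf{s}(g)$), both unital and associative, with $\vartheta(zg)=\vartheta(z)$, $\varsigma(hz)=\varsigma(z)$, $h(zg)=(hz)g$. It is left principal if $\varsigma$ is surjective and $\{(h,z)\mid\mathsf{s}(h)=\vartheta(z)\}\to\{(z,z')\mid\varsigma(z)=\varsigma(z')\}$, $(h,z)\mapsto(hz,z)$, is bijective; right principal if $\vartheta$ is surjective and $\{(z,g)\mid\varsigma(z)=\mathsf{t}(g)\}\to\{(z,z')\mid\vartheta(z)=\vartheta(z')\}$, $(z,g)\mapsto(z,zg)$, is bijective; principal if both. $\mathscr{U}(\mathscr{G})$ is the unit biset $G_1$ with left and right multiplication. Its pull-back $(\phi^{\varsigma})^*(\mathscr{U}(\mathscr{G}))$ is the $(\mathscr{G},\mathscr{G}^\varsigma)$-biset $Z=\{(f,x)\in G_1\times X\mid\mathsf{s}(f)=\varsigma(x)\}$ with structure maps $(f,x)\mapsto\mathsf{t}(f)\in G_0$ and $(f,x)\mapsto x\in X$, left action $g(f,x)=(gf,x)$ and right action $(f,x)(x,h,y)=(fh,y)$.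
   Formalization: In (i) and (iii) the set X is required to be nonempty; for X empty the claim fails, e.g. for the transitive groupoid with one object and one arrow, where the induced morphism is not essentially surjective and the pull-back biset is empty. *)

theory Defs
  imports Main "HOL-Library.FuncSet"
begin

record ('o, 'a) groupoid_data =
  Obj :: "'o set"
  Arr :: "'a set"
  src :: "'a \<Rightarrow> 'o"
  tgt :: "'a \<Rightarrow> 'o"
  idt :: "'o \<Rightarrow> 'a"
  cmp :: "'a \<Rightarrow> 'a \<Rightarrow> 'a" (infixl "\<odot>\<index>" 70)

text \<open>The composite \<open>f \<odot> g\<close> is meaningful only when \<open>src f = tgt g\<close> (apply \<open>g\<close> first).
  All operations are unconstrained outside the carriers \<open>Obj\<close> and \<open>Arr\<close>.\<close>

locale groupoid =
  fixes G :: "('o, 'a) groupoid_data" (structure)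
  assumes src_closed: "f \<in> Arr G \<Longrightarrow> src G f \<in> Obj G"
    and tgt_closed: "f \<in> Arr G \<Longrightarrow> tgt G f \<in> Obj G"
    and idt_closed: "x \<in> Obj G \<Longrightarrow> idt G x \<in> Arr G"
    and src_idt: "x \<in> Obj G \<Longrightarrow> src G (idt G x) = x"
    and tgt_idt: "x \<in> Obj G \<Longrightarrow> tgt G (idt G x) = x"
    and cmp_closed: "\<lbrakk>f \<in> Arr G; g \<in> Arr G; src G f = tgt G g\<rbrakk> \<Longrightarrow> f \<odot> g \<in> Arr G"
    and src_cmp: "\<lbrakk>f \<in> Arr G; g \<in> Arr G; src G f = tgt G g\<rbrakk> \<Longrightarrow> src G (f \<odot> g) = src G g"
    and tgt_cmp: "\<lbrakk>f \<in> Arr G; g \<in> Arr G; src G f = tgt G g\<rbrakk> \<Longrightarrow> tgt G (f \<odot> g) = tgt G f"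
    and cmp_assoc: "\<lbrakk>f \<in> Arr G; g \<in> Arr G; h \<in> Arr G; src G f = tgt G g; src G g = tgt G h\<rbrakk>
      \<Longrightarrow> (f \<odot> g) \<odot> h = f \<odot> (g \<odot> h)"
    and idt_left: "f \<in> Arr G \<Longrightarrow> idt G (tgt G f) \<odot> f = f"
    and idt_right: "f \<in> Arr G \<Longrightarrow> f \<odot> idt G (src G f) = f"
    and inverse_exists: "f \<in> Arr G \<Longrightarrow>
      \<exists>g\<in>Arr G. src G g = tgt G f \<and> tgt G g = src G f \<and>
        f \<odot> g = idt G (tgt G f) \<and> g \<odot> f = idt G (src G f)"

definition transitive_groupoid :: "('o, 'a) groupoid_data \<Rightarrow> bool" where
  "transitive_groupoid G \<longleftrightarrow> groupoid G \<and>
    (\<lambda>g. (src G g, tgt G g)) ` Arr G = Obj G \<times> Obj G"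

definition Hom :: "('o, 'a) groupoid_data \<Rightarrow> 'o \<Rightarrow> 'o \<Rightarrow> 'a set" where
  "Hom G x y = {g \<in> Arr G. src G g = x \<and> tgt G g = y}"

record ('o, 'a, 'p, 'b) functor_data =
  on_obj :: "'o \<Rightarrow> 'p"
  on_arr :: "'a \<Rightarrow> 'b"

locale groupoid_morphism = G: groupoid G + H: groupoid H
  for G :: "('o, 'a) groupoid_data" and H :: "('p, 'b) groupoid_data" +
  fixes F :: "('o, 'a, 'p, 'b) functor_data"
  assumes on_obj_closed: "x \<in> Obj G \<Longrightarrow> on_obj F x \<in> Obj H"
    and on_arr_closed: "f \<in> Arr G \<Longrightarrow> on_arr F f \<in> Arr H"
    and src_on_arr: "f \<in> Arr G \<Longrightarrow> src H (on_arr F f) = on_obj F (src G f)"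
    and tgt_on_arr: "f \<in> Arr G \<Longrightarrow> tgt H (on_arr F f) = on_obj F (tgt G f)"
    and on_arr_idt: "x \<in> Obj G \<Longrightarrow> on_arr F (idt G x) = idt H (on_obj F x)"
    and on_arr_cmp: "\<lbrakk>f \<in> Arr G; g \<in> Arr G; src G f = tgt G g\<rbrakk> \<Longrightarrow>
      on_arr F (f \<odot>\<^bsub>G\<^esub> g) = on_arr F f \<odot>\<^bsub>H\<^esub> on_arr F g"

text \<open>In a groupoid two objects are isomorphic as soon as there is an arrow between them.\<close>

definition essentially_surjective ::
  "('o, 'a) groupoid_data \<Rightarrow> ('p, 'b) groupoid_data \<Rightarrow> ('o, 'a, 'p, 'b) functor_data \<Rightarrow> bool" where
  "essentially_surjective G H F \<longleftrightarrow> (\<forall>y\<in>Obj H. \<exists>x\<in>Obj G. Hom H (on_obj F x) y \<noteq> {})"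

definition fully_faithful ::
  "('o, 'a) groupoid_data \<Rightarrow> ('p, 'b) groupoid_data \<Rightarrow> ('o, 'a, 'p, 'b) functor_data \<Rightarrow> bool" where
  "fully_faithful G H F \<longleftrightarrow>
    (\<forall>x\<in>Obj G. \<forall>y\<in>Obj G. bij_betw (on_arr F) (Hom G x y) (Hom H (on_obj F x) (on_obj F y)))"

definition weak_equivalence ::
  "('o, 'a) groupoid_data \<Rightarrow> ('p, 'b) groupoid_data \<Rightarrow> ('o, 'a, 'p, 'b) functor_data \<Rightarrow> bool" where
  "weak_equivalence G H F \<longleftrightarrow>
    groupoid_morphism G H F \<and> essentially_surjective G H F \<and> fully_faithful G H F"

definition induced_groupoid ::
  "('o, 'a) groupoid_data \<Rightarrow> 'x set \<Rightarrow> ('x \<Rightarrow> 'o) \<Rightarrow> ('x, 'x \<times> 'a \<times> 'x) groupoid_data" where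
  "induced_groupoid G X \<sigma> = \<lparr>
    Obj = X,
    Arr = {(x, g, x'). x \<in> X \<and> g \<in> Arr G \<and> x' \<in> X \<and> \<sigma> x = tgt G g \<and> \<sigma> x' = src G g},
    src = (\<lambda>(x, g, x'). x'),
    tgt = (\<lambda>(x, g, x'). x),
    idt = (\<lambda>x. (x, idt G (\<sigma> x), x)),
    cmp = (\<lambda>(x, g, y) (y', g', z). (x, g \<odot>\<^bsub>G\<^esub> g', z))\<rparr>"

definition induced_morphism :: "('x \<Rightarrow> 'o) \<Rightarrow> ('x, 'x \<times> 'a \<times> 'x, 'o, 'a) functor_data" where
  "induced_morphism \<sigma> = \<lparr>on_obj = \<sigma>, on_arr = (\<lambda>(x, g, x'). g)\<rparr>"

record ('p, 'b, 'o, 'a, 'z) biset_data =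
  Pts :: "'z set"
  lmap :: "'z \<Rightarrow> 'p"
  rmap :: "'z \<Rightarrow> 'o"
  lact :: "'b \<Rightarrow> 'z \<Rightarrow> 'z"
  ract :: "'z \<Rightarrow> 'a \<Rightarrow> 'z"

locale biset = H: groupoid H + G: groupoid G
  for H :: "('p, 'b) groupoid_data" and G :: "('o, 'a) groupoid_data" +
  fixes Z :: "('p, 'b, 'o, 'a, 'z) biset_data"
  assumes lmap_closed: "z \<in> Pts Z \<Longrightarrow> lmap Z z \<in> Obj H"
    and rmap_closed: "z \<in> Pts Z \<Longrightarrow> rmap Z z \<in> Obj G"
    and lact_closed: "\<lbrakk>h \<in> Arr H; z \<in> Pts Z; src H h = lmap Z z\<rbrakk> \<Longrightarrow> lact Z h z \<in> Pts Z"
    and ract_closed: "\<lbrakk>z \<in> Pts Z; g \<in> Arr G; rmap Z z = tgt G g\<rbrakk> \<Longrightarrow> ract Z z g \<in> Pts Z"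
    and lmap_lact: "\<lbrakk>h \<in> Arr H; z \<in> Pts Z; src H h = lmap Z z\<rbrakk> \<Longrightarrow> lmap Z (lact Z h z) = tgt H h"
    and rmap_ract: "\<lbrakk>z \<in> Pts Z; g \<in> Arr G; rmap Z z = tgt G g\<rbrakk> \<Longrightarrow> rmap Z (ract Z z g) = src G g"
    and rmap_lact: "\<lbrakk>h \<in> Arr H; z \<in> Pts Z; src H h = lmap Z z\<rbrakk> \<Longrightarrow> rmap Z (lact Z h z) = rmap Z z"
    and lmap_ract: "\<lbrakk>z \<in> Pts Z; g \<in> Arr G; rmap Z z = tgt G g\<rbrakk> \<Longrightarrow> lmap Z (ract Z z g) = lmap Z z"
    and lact_idt: "z \<in> Pts Z \<Longrightarrow> lact Z (idt H (lmap Z z)) z = z"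
    and ract_idt: "z \<in> Pts Z \<Longrightarrow> ract Z z (idt G (rmap Z z)) = z"
    and lact_cmp: "\<lbrakk>h \<in> Arr H; h' \<in> Arr H; z \<in> Pts Z; src H h = tgt H h'; src H h' = lmap Z z\<rbrakk> \<Longrightarrow>
      lact Z (h \<odot>\<^bsub>H\<^esub> h') z = lact Z h (lact Z h' z)"
    and ract_cmp: "\<lbrakk>z \<in> Pts Z; g \<in> Arr G; g' \<in> Arr G; rmap Z z = tgt G g; src G g = tgt G g'\<rbrakk> \<Longrightarrow>
      ract Z z (g \<odot>\<^bsub>G\<^esub> g') = ract Z (ract Z z g) g'"
    and lact_ract: "\<lbrakk>h \<in> Arr H; z \<in> Pts Z; g \<in> Arr G; src H h = lmap Z z; rmap Z z = tgt G g\<rbrakk> \<Longrightarrow>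
      lact Z h (ract Z z g) = ract Z (lact Z h z) g"

definition left_principal ::
  "('p, 'b) groupoid_data \<Rightarrow> ('o, 'a) groupoid_data \<Rightarrow> ('p, 'b, 'o, 'a, 'z) biset_data \<Rightarrow> bool" where
  "left_principal H G Z \<longleftrightarrow> biset H G Z \<and> rmap Z ` Pts Z = Obj G \<and>
    bij_betw (\<lambda>(h, z). (lact Z h z, z))
      {(h, z). h \<in> Arr H \<and> z \<in> Pts Z \<and> src H h = lmap Z z}
      {(z, z'). z \<in> Pts Z \<and> z' \<in> Pts Z \<and> rmap Z z = rmap Z z'}"

definition right_principal ::
  "('p, 'b) groupoid_data \<Rightarrow> ('o, 'a) groupoid_data \<Rightarrow> ('p, 'b, 'o, 'a, 'z) biset_data \<Rightarrow> bool" where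
  "right_principal H G Z \<longleftrightarrow> biset H G Z \<and> lmap Z ` Pts Z = Obj H \<and>
    bij_betw (\<lambda>(z, g). (z, ract Z z g))
      {(z, g). z \<in> Pts Z \<and> g \<in> Arr G \<and> rmap Z z = tgt G g}
      {(z, z'). z \<in> Pts Z \<and> z' \<in> Pts Z \<and> lmap Z z = lmap Z z'}"

definition principal ::
  "('p, 'b) groupoid_data \<Rightarrow> ('o, 'a) groupoid_data \<Rightarrow> ('p, 'b, 'o, 'a, 'z) biset_data \<Rightarrow> bool" where
  "principal H G Z \<longleftrightarrow> left_principal H G Z \<and> right_principal H G Z"

definition unit_biset :: "('o, 'a) groupoid_data \<Rightarrow> ('o, 'a, 'o, 'a, 'a) biset_data" where
  "unit_biset G = \<lparr>Pts = Arr G, lmap = tgt G, rmap = src G, lact = cmp G, ract = cmp G\<rparr>"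

text \<open>Pull-back of an \<open>(H, G)\<close>-biset \<open>Z\<close> along a morphism \<open>F\<close> from \<open>K\<close> to \<open>G\<close>, giving an
  \<open>(H, K)\<close>-biset: the points \<open>(z, x)\<close> with \<open>rmap z = F x\<close>, on which an arrow \<open>k\<close> of \<open>K\<close> with
  target \<open>x\<close> acts by \<open>(z, x) k = (z (F k), src k)\<close>.\<close>

definition pullback_biset ::
  "('q, 'c) groupoid_data \<Rightarrow> ('q, 'c, 'o, 'a) functor_data \<Rightarrow> ('p, 'b, 'o, 'a, 'z) biset_data \<Rightarrow>
    ('p, 'b, 'q, 'c, 'z \<times> 'q) biset_data" where
  "pullback_biset K F Z = \<lparr>
    Pts = {(z, x). z \<in> Pts Z \<and> x \<in> Obj K \<and> rmap Z z = on_obj F x},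
    lmap = (\<lambda>(z, x). lmap Z z),
    rmap = (\<lambda>(z, x). x),
    lact = (\<lambda>h (z, x). (lact Z h z, x)),
    ract = (\<lambda>(z, x) k. (ract Z z (on_arr F k), src K k))\<rparr>"

lemma pullback_unit_biset:
  "pullback_biset (induced_groupoid G X \<sigma>) (induced_morphism \<sigma>) (unit_biset G) = \<lparr>
    Pts = {(f, x). f \<in> Arr G \<and> x \<in> X \<and> src G f = \<sigma> x},
    lmap = (\<lambda>(f, x). tgt G f),
    rmap = (\<lambda>(f, x). x),
    lact = (\<lambda>g (f, x). (g \<odot>\<^bsub>G\<^esub> f, x)),
    ract = (\<lambda>(f, x) (x', h, y). (f \<odot>\<^bsub>G\<^esub> h, y))\<rparr>"
  by (auto simp: pullback_biset_def induced_groupoid_def induced_morphism_def unit_biset_def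
      fun_eq_iff)

end

theory Submission
  imports Defs
begin

text \<open>The morphism from an induced groupoid is always fully faithful, so it is a weak equivalence
  iff it is essentially surjective, and this holds for all nonempty \<open>X\<close> when \<open>G\<close> is transitive.
  The unit biset is principal; left principality is stable under pull-back along any morphism,
  and right principality under pull-back along a weak equivalence. Conversely, take \<open>X\<close> to be a
  point sent to \<open>a\<close>: essential surjectivity, or surjectivity of the left structure map of the
  pull-back, provides for each object \<open>b\<close> an arrow from \<open>a\<close> to \<open>b\<close>.\<close>

section \<open>Hom-sets and transitivity\<close>

lemma mem_HomD:
  assumes "g \<in> Hom G x y"
  shows "g \<in> Arr G" "src G g = x" "tgt G g = y"
  using assms by (simp_all add: Hom_def)

lemma transitive_groupoid_iff:
  "transitive_groupoid G \<longleftrightarrow> groupoid G \<and> (\<forall>a\<in>Obj G. \<forall>b\<in>Obj G. Hom G a b \<noteq> {})"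
proof (cases "groupoid G")
  case True
  then interpret groupoid G .
  have "(\<lambda>g. (src G g, tgt G g)) ` Arr G \<subseteq> Obj G \<times> Obj G"
    using src_closed tgt_closed by auto
  moreover have "Obj G \<times> Obj G \<subseteq> (\<lambda>g. (src G g, tgt G g)) ` Arr G \<longleftrightarrow>
      (\<forall>a\<in>Obj G. \<forall>b\<in>Obj G. Hom G a b \<noteq> {})"
    by (fastforce simp: Hom_def image_iff)
  ultimately show ?thesis
    using True by (auto simp: transitive_groupoid_def)
qed (simp add: transitive_groupoid_def)

section \<open>Cancellation and division in a groupoid\<close>

context groupoid
begin

lemma cmp_left_cancel:
  assumes f: "f \<in> Arr G" and g: "g \<in> Arr G" "tgt G g = src G f"
    and h: "h \<in> Arr G" "tgt G h = src G f" and eq: "f \<odot> g = f \<odot> h"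
  shows "g = h"
proof -
  obtain k where k: "k \<in> Arr G" "src G k = tgt G f" "tgt G k = src G f" "k \<odot> f = idt G (src G f)"
    using inverse_exists[OF f] by auto
  have "g = (k \<odot> f) \<odot> g" using k g idt_left[of g] by simp
  also have "\<dots> = k \<odot> (f \<odot> h)" using cmp_assoc[of k f g] k f g eq by simp
  also have "\<dots> = (k \<odot> f) \<odot> h" using cmp_assoc[of k f h] k f h by simp
  also have "\<dots> = h" using k h idt_left[of h] by simp
  finally show ?thesis .
qed

lemma cmp_right_cancel:
  assumes f: "f \<in> Arr G" and g: "g \<in> Arr G" "src G g = tgt G f"
    and h: "h \<in> Arr G" "src G h = tgt G f" and eq: "g \<odot> f = h \<odot> f"
  shows "g = h"
proof -
  obtain k where k: "k \<in> Arr G" "src G k = tgt G f" "tgt G k = src G f" "f \<odot> k = idt G (tgt G f)"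
    using inverse_exists[OF f] by auto
  have "g = g \<odot> (f \<odot> k)" using k g idt_right[of g] by simp
  also have "\<dots> = (h \<odot> f) \<odot> k" using cmp_assoc[of g f k] k f g eq by simp
  also have "\<dots> = h \<odot> (f \<odot> k)" using cmp_assoc[of h f k] k f h by simp
  also have "\<dots> = h" using k h idt_right[of h] by simp
  finally show ?thesis .
qed

text \<open>The quotient is \<open>k \<odot> f'\<close> with \<open>k\<close> inverse to
  \<open>f\<close>. Division yields the surjectivity half of principality of the unit biset,
  cancellation the injectivity half.\<close>

lemma cmp_left_division:
  assumes f: "f \<in> Arr G" and f': "f' \<in> Arr G" "tgt G f' = tgt G f"
  obtains g where "g \<in> Arr G" "tgt G g = src G f" "f \<odot> g = f'"
proof -
  obtain k where k: "k \<in> Arr G" "src G k = tgt G f" "tgt G k = src G f" "f \<odot> k = idt G (tgt G f)"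
    using inverse_exists[OF f] by auto
  show ?thesis
  proof (rule that)
    show "k \<odot> f' \<in> Arr G" "tgt G (k \<odot> f') = src G f"
      using k f' cmp_closed tgt_cmp by auto
    show "f \<odot> (k \<odot> f') = f'"
      using cmp_assoc[of f k f'] idt_left[of f'] k f f' by simp
  qed
qed

lemma cmp_right_division:
  assumes f: "f \<in> Arr G" and f': "f' \<in> Arr G" "src G f' = src G f"
  obtains g where "g \<in> Arr G" "src G g = tgt G f" "g \<odot> f = f'"
proof -
  obtain k where k: "k \<in> Arr G" "src G k = tgt G f" "tgt G k = src G f" "k \<odot> f = idt G (src G f)"
    using inverse_exists[OF f] by auto
  show ?thesis
  proof (rule that)
    show "f' \<odot> k \<in> Arr G" "src G (f' \<odot> k) = tgt G f"
      using k f' cmp_closed src_cmp by auto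
    show "f' \<odot> k \<odot> f = f'"
      using cmp_assoc[of f' k f] idt_right[of f'] k f f' by simp
  qed
qed

section \<open>The unit biset\<close>

lemma biset_unit_biset: "biset G G (unit_biset G)"
  by unfold_locales
    (auto simp: unit_biset_def src_closed tgt_closed cmp_closed src_cmp tgt_cmp idt_left idt_right
      cmp_assoc)

lemma left_principal_unit_biset: "left_principal G G (unit_biset G)"
proof -
  let ?Z = "unit_biset G"
  \<comment> \<open>Every object is the source of its own identity.\<close>
  have "src G ` Arr G = Obj G"
    using src_closed idt_closed src_idt by (auto intro!: rev_image_eqI)
  moreover have "bij_betw (\<lambda>(h, z). (h \<odot> z, z))
      {(h, z). h \<in> Arr G \<and> z \<in> Arr G \<and> src G h = tgt G z}
      {(z, z'). z \<in> Arr G \<and> z' \<in> Arr G \<and> src G z = src G z'}"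
    by (auto simp: bij_betw_def inj_on_def image_iff cmp_closed src_cmp
        intro: cmp_right_cancel) (metis cmp_right_division)
  ultimately show ?thesis
    using biset_unit_biset by (simp add: left_principal_def unit_biset_def)
qed

lemma right_principal_unit_biset: "right_principal G G (unit_biset G)"
proof -
  have "tgt G ` Arr G = Obj G"
    using tgt_closed idt_closed tgt_idt by (auto intro!: rev_image_eqI)
  moreover have "bij_betw (\<lambda>(z, g). (z, z \<odot> g))
      {(z, g). z \<in> Arr G \<and> g \<in> Arr G \<and> src G z = tgt G g}
      {(z, z'). z \<in> Arr G \<and> z' \<in> Arr G \<and> tgt G z = tgt G z'}"
    by (auto simp: bij_betw_def inj_on_def image_iff cmp_closed tgt_cmp
        intro: cmp_left_cancel) (metis cmp_left_division)
  ultimately show ?thesis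
    using biset_unit_biset by (simp add: right_principal_def unit_biset_def)
qed

section \<open>The induced groupoid and its morphism\<close>

lemma groupoid_induced_groupoid:
  assumes "\<sigma> \<in> X \<rightarrow> Obj G"
  shows "groupoid (induced_groupoid G X \<sigma>)"
proof
  \<comment> \<open>Only inverses call for a witness: invert the middle component and exchange the
    endpoints. The other axioms hold componentwise.\<close>
  fix p
  assume "p \<in> Arr (induced_groupoid G X \<sigma>)"
  then obtain x f y where p: "p = (x, f, y)" "x \<in> X" "f \<in> Arr G" "y \<in> X" "\<sigma> x = tgt G f"
      "\<sigma> y = src G f"
    by (auto simp: induced_groupoid_def)
  from inverse_exists[OF p(3)] obtain k where "k \<in> Arr G" "src G k = tgt G f" "tgt G k = src G f"
      "f \<odot> k = idt G (tgt G f)" "k \<odot> f = idt G (src G f)"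
    by auto
  with p show "\<exists>q\<in>Arr (induced_groupoid G X \<sigma>).
      src (induced_groupoid G X \<sigma>) q = tgt (induced_groupoid G X \<sigma>) p \<and>
      tgt (induced_groupoid G X \<sigma>) q = src (induced_groupoid G X \<sigma>) p \<and>
      p \<odot>\<^bsub>induced_groupoid G X \<sigma>\<^esub> q
        = idt (induced_groupoid G X \<sigma>) (tgt (induced_groupoid G X \<sigma>) p) \<and>
      q \<odot>\<^bsub>induced_groupoid G X \<sigma>\<^esub> p
        = idt (induced_groupoid G X \<sigma>) (src (induced_groupoid G X \<sigma>) p)"
    by (intro bexI[of _ "(y, k, x)"]) (auto simp: induced_groupoid_def)
qed (use assms in \<open>auto simp: induced_groupoid_def Pi_iff idt_closed src_idt tgt_idt cmp_closed
    src_cmp tgt_cmp cmp_assoc idt_left idt_right\<close>)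

lemma groupoid_morphism_induced_morphism:
  assumes "\<sigma> \<in> X \<rightarrow> Obj G"
  shows "groupoid_morphism (induced_groupoid G X \<sigma>) G (induced_morphism \<sigma>)"
proof -
  interpret I: groupoid "induced_groupoid G X \<sigma>"
    using assms by (rule groupoid_induced_groupoid)
  show ?thesis
    by unfold_locales (use assms in \<open>auto simp: induced_groupoid_def induced_morphism_def\<close>)
qed

lemma weak_equivalence_induced_morphism_iff:
  assumes "\<sigma> \<in> X \<rightarrow> Obj G"
  shows "weak_equivalence (induced_groupoid G X \<sigma>) G (induced_morphism \<sigma>) \<longleftrightarrow>
    (\<forall>b\<in>Obj G. \<exists>x\<in>X. Hom G (\<sigma> x) b \<noteq> {})"
proof -
  \<comment> \<open>An arrow from \<open>x\<close> to \<open>y\<close> is a triple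
    \<open>(y, g, x)\<close> with \<open>g\<close> from \<open>\<sigma> x\<close> to
    \<open>\<sigma> y\<close>. Since the endpoints are fixed, forgetting them is bijective on
    hom-sets.\<close>
  have "fully_faithful (induced_groupoid G X \<sigma>) G (induced_morphism \<sigma>)"
    by (auto simp: fully_faithful_def bij_betw_def inj_on_def image_iff Hom_def
        induced_groupoid_def induced_morphism_def)
  then show ?thesis
    using groupoid_morphism_induced_morphism[OF assms]
    by (simp add: weak_equivalence_def essentially_surjective_def)
      (simp add: induced_groupoid_def induced_morphism_def)
qed

end

section \<open>Pull-backs of principal bisets\<close>

lemma biset_pullback_biset:
  assumes "biset H G Z" and "groupoid_morphism K G F"
  shows "biset H K (pullback_biset K F Z)"
proof -
  interpret Z: biset H G Z by fact
  interpret F: groupoid_morphism K G F by fact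
  show ?thesis
    by unfold_locales
      (auto simp: pullback_biset_def Z.lmap_closed Z.lact_closed Z.ract_closed Z.lmap_lact
        Z.rmap_ract Z.rmap_lact Z.lmap_ract Z.lact_idt Z.lact_cmp Z.ract_cmp Z.lact_ract
        F.G.src_closed F.G.src_idt F.G.src_cmp F.on_arr_closed F.src_on_arr F.tgt_on_arr
        F.on_arr_idt F.on_arr_cmp, metis Z.ract_idt)
qed

text \<open>The fibre of the pull-back over \<open>x\<close> is a copy of the fibre of
  \<open>Z\<close> over \<open>on_obj F x\<close>, with the same left action. It is therefore again
  nonempty, and the action on it is again free and transitive.\<close>

lemma left_principal_pullback_biset:
  assumes Z: "left_principal H G Z" and F: "groupoid_morphism K G F"
  shows "left_principal H K (pullback_biset K F Z)"
proof -
  have "biset H G Z" and surj: "rmap Z ` Pts Z = Obj G"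
    and bij: "bij_betw (\<lambda>(h, z). (lact Z h z, z))
      {(h, z). h \<in> Arr H \<and> z \<in> Pts Z \<and> src H h = lmap Z z}
      {(z, z'). z \<in> Pts Z \<and> z' \<in> Pts Z \<and> rmap Z z = rmap Z z'}"
    using Z by (simp_all add: left_principal_def)
  interpret Z: biset H G Z by fact
  interpret F: groupoid_morphism K G F by fact
  \<comment> \<open>Bijectivity splits into freeness of the action (\<open>inj\<close>) and its
    transitivity on the fibres of \<open>rmap\<close> (\<open>ex\<close>).\<close>
  have inj: "h = h'" if "h \<in> Arr H" "h' \<in> Arr H" "z \<in> Pts Z" "src H h = lmap Z z"
      "src H h' = lmap Z z" "lact Z h z = lact Z h' z" for h h' z
    using inj_onD[OF bij_betw_imp_inj_on[OF bij], of "(h, z)" "(h', z)"] that by auto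
  have ex: "\<exists>h. h \<in> Arr H \<and> src H h = lmap Z z \<and> lact Z h z = z'"
    if "z \<in> Pts Z" "z' \<in> Pts Z" "rmap Z z' = rmap Z z" for z z'
  proof -
    have "(z', z) \<in> {(z, z'). z \<in> Pts Z \<and> z' \<in> Pts Z \<and> rmap Z z = rmap Z z'}"
      using that by simp
    then show ?thesis
      unfolding bij_betw_imp_surj_on[OF bij, symmetric] by auto
  qed
  have "\<exists>z\<in>Pts Z. rmap Z z = on_obj F x" if "x \<in> Obj K" for x
    using F.on_obj_closed[OF that] surj by (metis imageE)
  then have "rmap (pullback_biset K F Z) ` Pts (pullback_biset K F Z) = Obj K"
    by (fastforce simp: pullback_biset_def image_iff)
  moreover have "bij_betw (\<lambda>(h, p). (lact (pullback_biset K F Z) h p, p))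
      {(h, p). h \<in> Arr H \<and> p \<in> Pts (pullback_biset K F Z) \<and>
        src H h = lmap (pullback_biset K F Z) p}
      {(p, p'). p \<in> Pts (pullback_biset K F Z) \<and> p' \<in> Pts (pullback_biset K F Z) \<and>
        rmap (pullback_biset K F Z) p = rmap (pullback_biset K F Z) p'}"
    unfolding bij_betw_def
  proof (intro conjI equalityI subsetI)
    show "inj_on (\<lambda>(h, p). (lact (pullback_biset K F Z) h p, p))
      {(h, p). h \<in> Arr H \<and> p \<in> Pts (pullback_biset K F Z) \<and>
        src H h = lmap (pullback_biset K F Z) p}"
      by (auto simp: inj_on_def pullback_biset_def intro: inj)
  next
    fix q
    assume "q \<in> {(p, p'). p \<in> Pts (pullback_biset K F Z) \<and> p' \<in> Pts (pullback_biset K F Z) \<and>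
        rmap (pullback_biset K F Z) p = rmap (pullback_biset K F Z) p'}"
    then obtain z z' x where q: "q = ((z', x), (z, x))" "z \<in> Pts Z" "z' \<in> Pts Z" "x \<in> Obj K"
        "rmap Z z = on_obj F x" "rmap Z z' = on_obj F x"
      by (auto simp: pullback_biset_def)
    with ex[of z z'] obtain h where "h \<in> Arr H" "src H h = lmap Z z" "lact Z h z = z'"
      by auto
    with q show "q \<in> (\<lambda>(h, p). (lact (pullback_biset K F Z) h p, p)) `
      {(h, p). h \<in> Arr H \<and> p \<in> Pts (pullback_biset K F Z) \<and>
        src H h = lmap (pullback_biset K F Z) p}"
      by (intro image_eqI[of _ _ "(h, (z, x))"]) (auto simp: pullback_biset_def)
  qed (auto simp: pullback_biset_def Z.lact_closed Z.rmap_lact)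
  ultimately show ?thesis
    using biset_pullback_biset[OF \<open>biset H G Z\<close> F] by (simp add: left_principal_def)
qed

text \<open>Essential surjectivity moves a point of \<open>Z\<close> along the right action to one
  lying over the image of \<open>F\<close>. Full faithfulness lifts the unique arrow of
  \<open>G\<close> between two points of a fibre of \<open>lmap\<close> to a unique arrow of
  \<open>K\<close>.\<close>

lemma right_principal_pullback_biset:
  assumes Z: "right_principal H G Z" and F: "weak_equivalence K G F"
  shows "right_principal H K (pullback_biset K F Z)"
proof -
  have "biset H G Z" and surj: "lmap Z ` Pts Z = Obj H"
    and bij: "bij_betw (\<lambda>(z, g). (z, ract Z z g))
      {(z, g). z \<in> Pts Z \<and> g \<in> Arr G \<and> rmap Z z = tgt G g}
      {(z, z'). z \<in> Pts Z \<and> z' \<in> Pts Z \<and> lmap Z z = lmap Z z'}"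
    using Z by (simp_all add: right_principal_def)
  have morphism: "groupoid_morphism K G F"
    and es: "\<And>b. b \<in> Obj G \<Longrightarrow> \<exists>x\<in>Obj K. Hom G (on_obj F x) b \<noteq> {}"
    and ff: "\<And>x y. x \<in> Obj K \<Longrightarrow> y \<in> Obj K \<Longrightarrow>
      bij_betw (on_arr F) (Hom K x y) (Hom G (on_obj F x) (on_obj F y))"
    using F by (simp_all add: weak_equivalence_def essentially_surjective_def fully_faithful_def)
  interpret Z: biset H G Z by fact
  interpret F: groupoid_morphism K G F by fact
  let ?P = "pullback_biset K F Z"
  have inj: "g = g'" if "z \<in> Pts Z" "g \<in> Arr G" "g' \<in> Arr G" "rmap Z z = tgt G g"
      "rmap Z z = tgt G g'" "ract Z z g = ract Z z g'" for z g g'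
    using inj_onD[OF bij_betw_imp_inj_on[OF bij], of "(z, g)" "(z, g')"] that by auto
  have ex: "\<exists>g. g \<in> Arr G \<and> rmap Z z = tgt G g \<and> ract Z z g = z'"
    if "z \<in> Pts Z" "z' \<in> Pts Z" "lmap Z z = lmap Z z'" for z z'
  proof -
    have "(z, z') \<in> {(z, z'). z \<in> Pts Z \<and> z' \<in> Pts Z \<and> lmap Z z = lmap Z z'}"
      using that by simp
    then show ?thesis
      unfolding bij_betw_imp_surj_on[OF bij, symmetric] by auto
  qed
  have "lmap ?P ` Pts ?P = Obj H"
  proof (intro equalityI subsetI)
    fix a
    assume "a \<in> Obj H"
    then obtain z where z: "z \<in> Pts Z" "lmap Z z = a"
      using surj by (metis imageE)
    then obtain x g where x: "x \<in> Obj K" and "g \<in> Hom G (on_obj F x) (rmap Z z)"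
      using es[OF Z.rmap_closed] by blast
    note g = mem_HomD[OF this(2)]
    \<comment> \<open>Acting by \<open>g\<close> changes \<open>rmap\<close> from
      \<open>rmap Z z\<close> to \<open>on_obj F x\<close> and leaves \<open>lmap\<close> equal to
      \<open>a\<close>.\<close>
    have "(ract Z z g, x) \<in> Pts ?P" "lmap ?P (ract Z z g, x) = a"
      using z x g by (simp_all add: pullback_biset_def Z.ract_closed Z.rmap_ract Z.lmap_ract)
    then show "a \<in> lmap ?P ` Pts ?P"
      by force
  qed (auto simp: pullback_biset_def Z.lmap_closed)
  moreover have "bij_betw (\<lambda>(p, k). (p, ract ?P p k))
      {(p, k). p \<in> Pts ?P \<and> k \<in> Arr K \<and> rmap ?P p = tgt K k}
      {(p, p'). p \<in> Pts ?P \<and> p' \<in> Pts ?P \<and> lmap ?P p = lmap ?P p'}"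
    unfolding bij_betw_def
  proof (intro conjI equalityI subsetI)
    show "inj_on (\<lambda>(p, k). (p, ract ?P p k))
      {(p, k). p \<in> Pts ?P \<and> k \<in> Arr K \<and> rmap ?P p = tgt K k}"
    proof (rule inj_onI)
      fix u v
      assume "u \<in> {(p, k). p \<in> Pts ?P \<and> k \<in> Arr K \<and> rmap ?P p = tgt K k}"
        and "v \<in> {(p, k). p \<in> Pts ?P \<and> k \<in> Arr K \<and> rmap ?P p = tgt K k}"
        and "(\<lambda>(p, k). (p, ract ?P p k)) u = (\<lambda>(p, k). (p, ract ?P p k)) v"
      then obtain z x k k' where uv: "u = ((z, x), k)" "v = ((z, x), k')"
        and *: "(z, x) \<in> Pts ?P" "k \<in> Arr K" "rmap ?P (z, x) = tgt K k" "k' \<in> Arr K"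
          "rmap ?P (z, x) = tgt K k'" "ract ?P (z, x) k = ract ?P (z, x) k'"
        by auto
      \<comment> \<open>The second component of the right action is the source, so equal results
        make \<open>k\<close> and \<open>k'\<close> parallel, as faithfulness of \<open>F\<close>
        requires.\<close>
      from * have k: "k \<in> Hom K (src K k) x" "k' \<in> Hom K (src K k) x"
        and x: "src K k \<in> Obj K" "x \<in> Obj K"
        by (auto simp: pullback_biset_def Hom_def F.G.src_closed)
      have "on_arr F k = on_arr F k'"
        using * by (intro inj[of z]) (auto simp: pullback_biset_def F.on_arr_closed F.tgt_on_arr)
      then show "u = v"
        using inj_onD[OF bij_betw_imp_inj_on[OF ff[OF x]]] k uv by blast
    qed
  next
    fix q
    assume "q \<in> {(p, p'). p \<in> Pts ?P \<and> p' \<in> Pts ?P \<and> lmap ?P p = lmap ?P p'}"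
    then obtain z x z' x' where q: "q = ((z, x), (z', x'))" "z \<in> Pts Z" "z' \<in> Pts Z"
        "x \<in> Obj K" "x' \<in> Obj K" "rmap Z z = on_obj F x" "rmap Z z' = on_obj F x'"
        "lmap Z z = lmap Z z'"
      by (auto simp: pullback_biset_def)
    with ex[of z z'] obtain g where g: "g \<in> Arr G" "rmap Z z = tgt G g" "ract Z z g = z'"
      by auto
    \<comment> \<open>The target of \<open>g\<close> is \<open>rmap Z z\<close> and its source is
      \<open>rmap Z z'\<close>, so \<open>g\<close> runs between images of objects of
      \<open>K\<close> and fullness applies.\<close>
    with q have "g \<in> Hom G (on_obj F x') (on_obj F x)"
      by (auto simp: Hom_def Z.rmap_ract)
    then obtain k where k: "k \<in> Hom K x' x" "on_arr F k = g"
      using bij_betw_imp_surj_on[OF ff[OF q(5,4)]] by (metis imageE)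
    with q g show "q \<in> (\<lambda>(p, k). (p, ract ?P p k)) `
        {(p, k). p \<in> Pts ?P \<and> k \<in> Arr K \<and> rmap ?P p = tgt K k}"
      by (intro image_eqI[of _ _ "((z, x), k)"]) (auto simp: pullback_biset_def Hom_def)
  qed (auto simp: pullback_biset_def Z.ract_closed Z.rmap_ract Z.lmap_ract F.G.src_closed
      F.on_arr_closed F.src_on_arr F.tgt_on_arr)
  ultimately show ?thesis
    using biset_pullback_biset[OF \<open>biset H G Z\<close> morphism] by (simp add: right_principal_def)
qed

section \<open>Equivalence of transitivity, weak equivalence and principality\<close>

theorem proposition2p15:
  fixes G :: "('o, 'a) groupoid_data"
  assumes "groupoid G"
  shows "((\<forall>(X :: 'x set) \<sigma>. X \<noteq> {} \<and> \<sigma> \<in> X \<rightarrow> Obj G \<longrightarrow>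
            weak_equivalence (induced_groupoid G X \<sigma>) G (induced_morphism \<sigma>))
          \<longleftrightarrow> transitive_groupoid G)
       \<and> (transitive_groupoid G \<longleftrightarrow>
          (\<forall>(X :: 'x set) \<sigma>. X \<noteq> {} \<and> \<sigma> \<in> X \<rightarrow> Obj G \<longrightarrow>
            principal G (induced_groupoid G X \<sigma>)
              (pullback_biset (induced_groupoid G X \<sigma>) (induced_morphism \<sigma>) (unit_biset G))))"
    (is "(?I \<longleftrightarrow> ?T) \<and> (?T \<longleftrightarrow> ?P)")
proof -
  interpret groupoid G by fact
  \<comment> \<open>Transitivity joins \<open>\<sigma> x\<close> to any object, for any
    \<open>x\<close> in \<open>X\<close>. For empty \<open>X\<close> the induced groupoid has no
    objects, and essential surjectivity would fail as soon as \<open>G\<close> has one.\<close>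
  have TI: ?I if ?T
    using that
    by (auto simp: weak_equivalence_induced_morphism_iff transitive_groupoid_iff Pi_iff)
  have IP: ?P if ?I
  proof (intro allI impI)
    fix X :: "'x set" and \<sigma>
    assume X: "X \<noteq> {} \<and> \<sigma> \<in> X \<rightarrow> Obj G"
    then have we: "weak_equivalence (induced_groupoid G X \<sigma>) G (induced_morphism \<sigma>)"
      using that by simp
    then have "groupoid_morphism (induced_groupoid G X \<sigma>) G (induced_morphism \<sigma>)"
      by (simp add: weak_equivalence_def)
    from left_principal_pullback_biset[OF left_principal_unit_biset this]
      right_principal_pullback_biset[OF right_principal_unit_biset we]
    show "principal G (induced_groupoid G X \<sigma>)
        (pullback_biset (induced_groupoid G X \<sigma>) (induced_morphism \<sigma>) (unit_biset G))"
      by (simp add: principal_def)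
  qed
  have PT: ?T if ?P
    unfolding transitive_groupoid_iff
  proof (intro conjI ballI)
    fix a b
    assume a: "a \<in> Obj G" and b: "b \<in> Obj G"
    \<comment> \<open>Every type is inhabited, so \<open>'x\<close> contains a one-point set;
      \<open>undefined\<close> is an arbitrary choice of its element.\<close>
    let ?X = "{undefined :: 'x}" and ?\<sigma> = "\<lambda>_ :: 'x. a"
    let ?Z = "pullback_biset (induced_groupoid G ?X ?\<sigma>) (induced_morphism ?\<sigma>) (unit_biset G)"
    have "principal G (induced_groupoid G ?X ?\<sigma>) ?Z"
      using that[rule_format, of ?X ?\<sigma>] a by simp
    \<comment> \<open>A point of \<open>?Z\<close> is an arrow with source \<open>a\<close> paired
      with the single element of \<open>?X\<close>, and \<open>lmap\<close> is its target.\<close>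
    then have "b \<in> lmap ?Z ` Pts ?Z"
      using b by (simp add: principal_def right_principal_def)
    then show "Hom G a b \<noteq> {}"
      unfolding pullback_unit_biset by (auto simp: Hom_def)
  qed fact
  \<comment> \<open>Both equivalences follow from the cycle \<open>?T\<close> to \<open>?I\<close>
    to \<open>?P\<close> to \<open>?T\<close>.\<close>
  show ?thesis
    by (intro conjI iffI) (erule PT[OF IP] TI IP[OF TI] PT)+
qed

end
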